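(* Let $\overline{\gamma}>0$, $q\in(0,1]$ and $\gamma_o>0$. Let $\mathcal{X}$ be a random variable following the squared Hoyt distribution with average $\overline{\gamma}$ and parameter $q$, and let $\mathcal{Y}$ be an arbitrarily distributed nonnegative random variable independent of $\mathcal{X}$, with moment generating function $\phi_{\mathcal{Y}}(s)=\mathbb{E}\{e^{s\mathcal{Y}}\}$. Then the outage probability $P_{out}(\gamma_o)=P\big(\mathcal{X}<\gamma_o(\mathcal{Y}+1)\big)$ is given by $$P_{out}(\gamma_o)=1-\frac{1}{\pi}\int_0^\pi e^{-\gamma_o/\gamma(\theta,q)}\,\phi_{\mathcal{Y}}\left(-\frac{\gamma_o}{\gamma(\theta,q)}\right)d\theta,\qquad \gamma(\theta,q)=\overline{\gamma}\left(1-\frac{1-q^2}{1+q^2}\cos\theta\right).$$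
   Context: The squared Hoyt distribution with average $\overline{\gamma}>0$ and parameter $q\in(0,1]$ has pdf on $[0,\infty)$ $$f(x)=\frac{1+q^2}{2q\overline{\gamma}}\exp\left[-\frac{(1+q^2)^2x}{4q^2\overline{\gamma}}\right]I_0\left(\frac{(1-q^4)x}{4q^2\overline{\gamma}}\right),$$ where $I_0$ is the modified Bessel function of the first kind and order zero. In the application, $\mathcal{X}$ is the signal-to-noise ratio of the desired signal (under Hoyt fading), $\mathcal{Y}$ is the total interference-to-noise ratio of the co-channel interferers, and $\gamma_o$ is the outage threshold for the signal-to-interference-plus-noise ratio. *)

theory Defs
  imports "HOL-Probability.Probability"
begin

text \<open>
  Modified Bessel function of the first kind of integer order \<open>n \<ge> 0\<close>, by its power series.
\<close>

definition bessel_I :: "nat \<Rightarrow> real \<Rightarrow> real" where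
  "bessel_I n x = (\<Sum>k. (x / 2) ^ (2 * k + n) / (fact k * fact (k + n)))"

definition squared_hoyt_density :: "real \<Rightarrow> real \<Rightarrow> real \<Rightarrow> real" where
  "squared_hoyt_density \<gamma>avg q x =
     (if x < 0 then 0
      else (1 + q\<^sup>2) / (2 * q * \<gamma>avg)
             * exp (- ((1 + q\<^sup>2)\<^sup>2 * x / (4 * q\<^sup>2 * \<gamma>avg)))
             * bessel_I 0 ((1 - q ^ 4) * x / (4 * q\<^sup>2 * \<gamma>avg)))"

definition moment_gen_fun :: "'a measure \<Rightarrow> ('a \<Rightarrow> real) \<Rightarrow> real \<Rightarrow> real" where
  "moment_gen_fun M Y s = (\<integral>\<omega>. exp (s * Y \<omega>) \<partial>M)"

definition hoyt_gamma :: "real \<Rightarrow> real \<Rightarrow> real \<Rightarrow> real" where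
  "hoyt_gamma \<gamma>avg \<theta> q = \<gamma>avg * (1 - (1 - q\<^sup>2) / (1 + q\<^sup>2) * cos \<theta>)"

end

theory Submission
  imports Defs
begin

text \<open>
  Write \<open>r = (1 - q\<^sup>2) / (1 + q\<^sup>2)\<close>. The integral representation of \<open>I\<^sub>0\<close> exhibits the squared Hoyt
  density as a mixture over \<open>\<phi> \<in> [0, \<pi>]\<close> of exponentials with rates proportional to
  \<open>1 + r * cos \<phi>\<close>. Hence the tail of \<open>X\<close> is a mixture of exponentials with weights
  \<open>sqrt (1 - r\<^sup>2) / (1 + r * cos \<phi>)\<close>, and passing from the true anomaly \<open>\<phi>\<close> to the
  eccentric anomaly \<open>\<theta>\<close> makes the weight constant while turning the rate into \<open>1 / \<gamma>(\<theta>, q)\<close>. Averaging this tail at \<open>\<gamma>o * (Y + 1)\<close>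
  over the law of the independent \<open>Y\<close> brings in the moment generating function.
\<close>

text \<open>A bridge between two integrals: interchanging the order of integration is easiest for
  nonnegative integrals, while the Bessel representation and the substitution use the gauge
  integral.\<close>

lemma nn_integral_continuous_on_Icc:
  fixes f :: "real \<Rightarrow> real"
  assumes "continuous_on {a..b} f" and nonneg: "\<And>x. x \<in> {a..b} \<Longrightarrow> 0 \<le> f x"
  shows "(\<integral>\<^sup>+x\<in>{a..b}. ennreal (f x) \<partial>lborel) = ennreal (integral {a..b} f)"
proof -
  have int: "set_integrable lborel {a..b} f"
    by (rule borel_integrable_atLeastAtMost') fact
  have "(\<integral>\<^sup>+x\<in>{a..b}. ennreal (f x) \<partial>lborel) = (\<integral>\<^sup>+x. ennreal (indicator {a..b} x *\<^sub>R f x) \<partial>lborel)"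
    by (rule nn_integral_cong) (simp split: split_indicator)
  also have "\<dots> = ennreal (LINT x:{a..b}|lborel. f x)"
    unfolding set_lebesgue_integral_def
    using int nonneg by (intro nn_integral_eq_integral) (auto simp: set_integrable_def split: split_indicator)
  finally show ?thesis
    by (simp add: set_borel_integral_eq_integral(2)[OF int])
qed

section \<open>Cosine moments and the integral representation of I_0\<close>

text \<open>Integration by parts in disguise: \<open>sin x * cos x ^ Suc n\<close> has derivative (n
  + 2) cos^(n+2) x - (n + 1) cos^n x and vanishes at both ends.\<close>

lemma has_integral_cos_power_Suc_Suc:
  assumes "((\<lambda>x. cos x ^ n) has_integral I) {0..pi}"
  shows "((\<lambda>x. cos x ^ Suc (Suc n)) has_integral (real n + 1) / (real n + 2) * I) {0..pi}"
proof -
  let ?D = "\<lambda>x::real. real (n + 2) * cos x ^ Suc (Suc n) - real (n + 1) * cos x ^ n"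
  have "(?D has_integral (sin pi * cos pi ^ Suc n - sin 0 * cos 0 ^ Suc n)) {0..pi}"
  proof (rule fundamental_theorem_of_calculus)
    fix x :: real
    have "((\<lambda>x. sin x * cos x ^ Suc n) has_real_derivative
        cos x ^ Suc (Suc n) - real (Suc n) * cos x ^ n * (sin x)\<^sup>2) (at x within {0..pi})"
      by (rule derivative_eq_intros refl)+ (simp add: power2_eq_square algebra_simps)
    moreover have "cos x ^ Suc (Suc n) - real (Suc n) * cos x ^ n * (sin x)\<^sup>2 = ?D x"
      unfolding sin_squared_eq by (simp add: algebra_simps power2_eq_square)
    ultimately show "((\<lambda>x. sin x * cos x ^ Suc n) has_vector_derivative ?D x) (at x within {0..pi})"
      by (simp add: has_real_derivative_iff_has_vector_derivative)
  qed simp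
  then have "(?D has_integral 0) {0..pi}" by simp
  from has_integral_add[OF this has_integral_mult_right[OF assms, of "real (n + 1)"]]
  have "((\<lambda>x. real (n + 2) * cos x ^ Suc (Suc n)) has_integral real (n + 1) * I) {0..pi}"
    by simp
  from has_integral_mult_right[OF this, of "1 / real (n + 2)"] show ?thesis
    by (simp add: add_ac)
qed

text \<open>The recursion, started from pi at exponent 0, yields Wallis's value pi binom(2k, k) /
  4^k. In factorial form, (2k)! cancels against the exponential series.\<close>

lemma has_integral_cos_power_even:
  "((\<lambda>x. cos x ^ (2 * k)) has_integral pi * fact (2 * k) / (4 ^ k * (fact k)\<^sup>2)) {0..pi}"
proof (induction k)
  case 0
  show ?case using has_integral_const_real[of "1::real" 0 pi] by simp
next
  case (Suc k)
  have "(real (2 * k) + 1) / (real (2 * k) + 2) * (pi * fact (2 * k) / (4 ^ k * (fact k)\<^sup>2))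
      = pi * fact (2 * Suc k) / (4 ^ Suc k * (fact (Suc k))\<^sup>2)"
    by (simp add: divide_simps power2_eq_square) (simp add: algebra_simps)
  with has_integral_cos_power_Suc_Suc[OF Suc] show ?case by simp
qed

lemma has_integral_cos_power_odd:
  "((\<lambda>x. cos x ^ (2 * k + 1)) has_integral 0) {0..pi}"
proof (induction k)
  case 0
  have "(cos has_integral (sin pi - sin 0)) {0..pi}"
    by (rule fundamental_theorem_of_calculus)
       (auto intro!: derivative_eq_intros simp flip: has_real_derivative_iff_has_vector_derivative)
  then show ?case by simp
next
  case (Suc k)
  from has_integral_cos_power_Suc_Suc[OF Suc] show ?case by simp
qed

text \<open>Integrate the exponential series term by term: odd cosine moments vanish, and even ones
  turn z^(2k) / (2k)! into pi (z/2)^(2k) / (k!)^2.\<close>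

lemma has_integral_exp_cos:
  "((\<lambda>x. exp (z * cos x)) has_integral pi * bessel_I 0 z) {0..pi}"
proof -
  define c :: "nat \<Rightarrow> real" where "c n = integral {0..pi} (\<lambda>x. cos x ^ n)" for n
  have c_even: "c (2 * k) = pi * fact (2 * k) / (4 ^ k * (fact k)\<^sup>2)" for k
    unfolding c_def by (rule integral_unique, rule has_integral_cos_power_even)
  have c_odd: "c n = 0" if "odd n" for n
  proof -
    from that obtain k where "n = 2 * k + 1" by (rule oddE)
    then show ?thesis
      unfolding c_def by (metis integral_unique has_integral_cos_power_odd)
  qed
  let ?f = "\<lambda>n x. (z * cos x) ^ n /\<^sub>R fact n"
  \<comment> \<open>As |cos x| \<le> 1, the majorant |z|^n / n! is free of x; this justifies
    exchanging sum and integral.\<close>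
  have "uniform_limit {0..pi} (\<lambda>n x. \<Sum>i<n. ?f i x) (\<lambda>x. \<Sum>i. ?f i x) sequentially"
  proof (rule Weierstrass_m_test)
    fix n x
    have "\<bar>z * cos x\<bar> ^ n \<le> \<bar>z\<bar> ^ n"
      by (intro power_mono) (auto simp: abs_mult intro: mult_left_le)
    then show "norm (?f n x) \<le> \<bar>z\<bar> ^ n /\<^sub>R fact n"
      by (simp add: power_abs abs_mult divide_right_mono divide_inverse_commute flip: power_mult_distrib)
  next
    show "summable (\<lambda>n. \<bar>z\<bar> ^ n /\<^sub>R fact n)"
      using exp_converges[of "\<bar>z\<bar>"] by (simp add: sums_iff)
  qed
  then have lim: "uniform_limit {0..pi} (\<lambda>n x. \<Sum>i<n. ?f i x) (\<lambda>x. exp (z * cos x)) sequentially"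
    by (simp add: exp_def)
  \<comment> \<open>The values are abstract at first; uniqueness of integrals then identifies
    \<open>I\<close> with explicit partial sums, so \<open>J\<close> is the sum of their
    series.\<close>
  obtain I J where I: "\<And>n. ((\<lambda>x. \<Sum>i<n. ?f i x) has_integral I n) {0..pi}"
    and J: "((\<lambda>x. exp (z * cos x)) has_integral J) {0..pi}" and IJ: "I \<longlonglongrightarrow> J"
    by (rule uniform_limit_integral[OF lim]) (auto intro!: continuous_intros)
  have "((\<lambda>x. \<Sum>i<n. ?f i x) has_integral (\<Sum>i<n. z ^ i / fact i * c i)) {0..pi}" for n
  proof (rule has_integral_sum)
    fix i
    have "((\<lambda>x. cos x ^ i) has_integral c i) {0..pi}"
      unfolding c_def
      by (intro integrable_integral integrable_continuous_real continuous_intros)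
    from has_integral_mult_right[OF this, of "z ^ i / fact i"]
    show "(?f i has_integral z ^ i / fact i * c i) {0..pi}"
      by (simp add: power_mult_distrib field_simps)
  qed simp
  then have "I = (\<lambda>n. \<Sum>i<n. z ^ i / fact i * c i)"
    using I by (intro ext has_integral_unique)
  with IJ have sums: "(\<lambda>i. z ^ i / fact i * c i) sums J"
    by (simp add: sums_def)
  have "(\<lambda>k. z ^ (2 * k) / fact (2 * k) * c (2 * k)) sums J"
  proof (subst sums_mono_reindex[of "\<lambda>k. 2 * k"])
    show "z ^ n / fact n * c n = 0" if "n \<notin> range (\<lambda>k. 2 * k)" for n
      using that c_odd[of n] by (auto elim!: evenE)
  qed (use sums in \<open>auto simp: strict_mono_def\<close>)
  moreover have "z ^ (2 * k) / fact (2 * k) * c (2 * k)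
      = pi * ((z / 2) ^ (2 * k + 0) / (fact k * fact (k + 0)))" for k
    by (simp add: c_even power_divide power_mult power2_eq_square)
  ultimately have "(\<lambda>k. pi * ((z / 2) ^ (2 * k + 0) / (fact k * fact (k + 0)))) sums J"
    by simp
  from sums_mult[OF this, of "1 / pi"]
  have "bessel_I 0 z = J / pi"
    unfolding bessel_I_def by (simp add: sums_iff)
  with J show ?thesis by simp
qed

text \<open>The substitution \<open>cos \<theta> = (cos \<phi> + r) / (1 + r * cos \<phi>)\<close> is Kepler's relation between
  the eccentric anomaly \<open>\<theta>\<close> and the true anomaly \<open>\<phi>\<close> for eccentricity \<open>r\<close>.\<close>

lemma integral_anomaly_substitution:
  fixes h :: "real \<Rightarrow> real"
  assumes r: "\<bar>r\<bar> < 1" and h: "continuous_on UNIV h"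
  shows "integral {0..pi} (\<lambda>\<theta>. h (1 / (1 - r * cos \<theta>))) =
    integral {0..pi} (\<lambda>\<phi>. sqrt (1 - r\<^sup>2) / (1 + r * cos \<phi>) * h ((1 + r * cos \<phi>) / (1 - r\<^sup>2)))"
proof -
  have rc: "\<bar>r * cos x\<bar> < 1" for x
    using r mult_left_le[of "\<bar>cos x\<bar>" "\<bar>r\<bar>"] by (simp add: abs_mult)
  then have pos: "1 + r * cos x > 0" "1 - r * cos x > 0" for x
    unfolding abs_less_iff by (smt (verit))+
  have r2: "1 - r\<^sup>2 > 0" using r by (simp add: abs_square_less_1)
  define u where "u = (\<lambda>x. (cos x + r) / (1 + r * cos x))"
  \<comment> \<open>This factorisation serves twice: it bounds |u| by 1, so that \<open>cos\<close>
    inverts \<open>arccos\<close> at \<open>u x\<close>, and it supplies the root in the derivative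
    of \<open>arccos\<close>.\<close>
  have u2: "1 - (u x)\<^sup>2 = (1 - r\<^sup>2) * (sin x)\<^sup>2 / (1 + r * cos x)\<^sup>2" for x
  proof -
    have "1 - (u x)\<^sup>2 = ((1 + r * cos x)\<^sup>2 - (cos x + r)\<^sup>2) / (1 + r * cos x)\<^sup>2"
      using pos(1)[of x] by (simp add: u_def power_divide diff_divide_distrib)
    also have "(1 + r * cos x)\<^sup>2 - (cos x + r)\<^sup>2 = (1 - r\<^sup>2) * (sin x)\<^sup>2"
      unfolding sin_squared_eq by (simp add: algebra_simps power2_eq_square)
    finally show ?thesis .
  qed
  have u_bd: "\<bar>u x\<bar> \<le> 1" for x
  proof -
    have "0 \<le> 1 - (u x)\<^sup>2" unfolding u2 using r2 by (intro divide_nonneg_nonneg mult_nonneg_nonneg) auto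
    then show ?thesis by (simp add: abs_square_le_1)
  qed
  have u_cont: "continuous_on {0..pi} u"
    unfolding u_def using pos by (intro continuous_intros) (metis less_irrefl)
  let ?g = "\<lambda>x. arccos (u x)"
  let ?f = "\<lambda>\<theta>. h (1 / (1 - r * cos \<theta>))"
  let ?g' = "\<lambda>x. sqrt (1 - r\<^sup>2) / (1 + r * cos x)"
  have "((\<lambda>x. ?g' x *\<^sub>R ?f (?g x)) has_integral
      (integral {?g 0..?g pi} ?f - integral {?g pi..?g 0} ?f)) {0..pi}"
  \<comment> \<open>At 0 and pi, \<open>u\<close> takes the values 1 and -1, where
    \<open>arccos\<close> is not differentiable; hence the exceptional set.\<close>
  proof (rule has_integral_substitution_general[where s = "{0, pi}" and c = 0 and d = pi])
    show "?g ` {0..pi} \<subseteq> {0..pi}"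
      using u_bd by (auto simp: abs_le_iff minus_le_iff intro!: arccos_lbound arccos_ubound)
    have "continuous_on {0..pi} (\<lambda>\<theta>. 1 / (1 - r * cos \<theta>))"
      using pos by (intro continuous_intros) (metis less_irrefl)
    then show "continuous_on {0..pi} ?f"
      using h continuous_on_compose2[of UNIV h] by blast
    show "continuous_on {0..pi} ?g"
      using u_bd u_cont by (intro continuous_on_arccos) (auto simp: abs_le_iff minus_le_iff)
  next
    fix x assume x: "x \<in> {0..pi} - {0, pi}"
    then have s: "sin x > 0" by (intro sin_gt_zero) auto
    have "0 < 1 - (u x)\<^sup>2"
      unfolding u2 using r2 s pos(1)[of x] by (intro divide_pos_pos mult_pos_pos) auto
    then have "\<bar>u x\<bar> < 1" by (simp add: abs_square_less_1)
    then have ux: "-1 < u x" "u x < 1" by auto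
    have "sqrt (1 - (u x)\<^sup>2) = sqrt (1 - r\<^sup>2) * sin x / (1 + r * cos x)"
      unfolding u2 using s pos(1)[of x] by (simp add: real_sqrt_mult real_sqrt_divide)
    moreover have "(u has_real_derivative (r\<^sup>2 - 1) * sin x / (1 + r * cos x)\<^sup>2) (at x within {0..pi})"
      unfolding u_def using pos(1)[of x]
      by (auto intro!: derivative_eq_intros simp: power2_eq_square algebra_simps)
    \<comment> \<open>Both factors are negative, so the angle increases; sin x cancels, and 1 - r^2
      is the square of its root.\<close>
    moreover have "inverse (- (sqrt (1 - r\<^sup>2) * sin x / (1 + r * cos x)))
        * ((r\<^sup>2 - 1) * sin x / (1 + r * cos x)\<^sup>2) = ?g' x"
      using s pos(1)[of x] r2 real_sqrt_mult_self[of "1 - r\<^sup>2"]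
      by (simp add: divide_simps) (simp add: power2_eq_square algebra_simps)
    ultimately show "(?g has_real_derivative ?g' x) (at x within {0..pi})"
      using DERIV_chain2[of arccos _ u, OF DERIV_arccos[OF ux]] by metis
  qed auto
  \<comment> \<open>Hence \<open>?g\<close> fixes both endpoints, and the subtracted integral runs
    over the empty interval \<open>{pi..0}\<close>.\<close>
  moreover have "u 0 = 1" "u pi = -1"
    unfolding u_def using pos(1)[of 0] pos(1)[of pi] by (auto simp: field_simps)
  \<comment> \<open>An equivalent form of the substitution: (1 - r cos \<theta>)(1 + r cos \<phi>) =
    1 - r^2.\<close>
  moreover have "1 / (1 - r * cos (?g x)) = (1 + r * cos x) / (1 - r\<^sup>2)" for x
  proof -
    have "cos (?g x) = u x" using u_bd[of x] by (intro cos_arccos_abs)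
    moreover have "1 - r * u x = (1 - r\<^sup>2) / (1 + r * cos x)"
      unfolding u_def using pos(1)[of x] by (simp add: field_simps power2_eq_square)
    ultimately show ?thesis by simp
  qed
  ultimately show ?thesis
    by (simp add: integral_unique)
qed

section \<open>The tail of the squared Hoyt distribution\<close>

text \<open>The parameter r rationalises everything: 1 - r^2 is the square of 2q / (1 + q^2), and r
  (1 + q^2)^2 = (1 - q^2)(1 + q^2) = 1 - q^4.\<close>

lemma squared_hoyt_density_eq:
  fixes q :: real
  assumes "0 < q" "0 < g" "0 \<le> x" and r: "r = (1 - q\<^sup>2) / (1 + q\<^sup>2)"
  shows "squared_hoyt_density g q x =
    exp (- (x / (g * (1 - r\<^sup>2)))) * bessel_I 0 (r * x / (g * (1 - r\<^sup>2))) / (g * sqrt (1 - r\<^sup>2))"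
proof -
  have q2: "0 < 1 + q\<^sup>2" by (simp add: add_pos_nonneg)
  have "1 - r\<^sup>2 = ((1 + q\<^sup>2)\<^sup>2 - (1 - q\<^sup>2)\<^sup>2) / (1 + q\<^sup>2)\<^sup>2"
    using q2 unfolding r power_divide by (simp add: diff_divide_distrib)
  also have "(1 + q\<^sup>2)\<^sup>2 - (1 - q\<^sup>2)\<^sup>2 = (2 * q)\<^sup>2"
    by (simp add: power2_eq_square algebra_simps)
  finally have r2: "1 - r\<^sup>2 = (2 * q / (1 + q\<^sup>2))\<^sup>2"
    by (simp add: power_divide)
  then have "sqrt (1 - r\<^sup>2) = 2 * q / (1 + q\<^sup>2)"
    using q2 \<open>0 < q\<close> by simp
  moreover have "x / (g * (1 - r\<^sup>2)) = (1 + q\<^sup>2)\<^sup>2 * x / (4 * q\<^sup>2 * g)"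
    by (simp add: r2 power_divide power_mult_distrib mult_ac)
  moreover have "r * x / (g * (1 - r\<^sup>2)) = (1 - q ^ 4) * x / (4 * q\<^sup>2 * g)"
  proof -
    have "r * x / (g * (1 - r\<^sup>2)) = (r * (1 + q\<^sup>2)\<^sup>2) * x / (4 * q\<^sup>2 * g)"
      by (simp add: r2 power_divide power_mult_distrib mult_ac)
    also have "r * (1 + q\<^sup>2)\<^sup>2 = 1 - q ^ 4"
      using q2 unfolding r by (simp add: power2_eq_square power4_eq_xxxx) (simp add: algebra_simps)
    finally show ?thesis .
  qed
  ultimately show ?thesis
    using \<open>0 \<le> x\<close> by (simp add: squared_hoyt_density_def mult_ac)
qed

lemma nn_integral_exp_tail:
  fixes a b t :: real
  assumes "0 < a" "0 \<le> b"
  shows "(\<integral>\<^sup>+x\<in>{t..}. ennreal (b * exp (- (a * x))) \<partial>lborel) = ennreal (b / a * exp (- (a * t)))"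
proof -
  have "((\<lambda>x. - (b / a * exp (- (a * x)))) \<longlongrightarrow> 0) at_top"
    using \<open>0 < a\<close> by real_asymp
  moreover have "((\<lambda>x. - (b / a * exp (- (a * x)))) has_real_derivative b * exp (- (a * x))) (at x)" for x
    using \<open>0 < a\<close> by (auto intro!: derivative_eq_intros)
  ultimately show ?thesis
    using \<open>0 \<le> b\<close> by (subst nn_integral_FTC_atLeast) auto
qed

text \<open>Probabilistically, X is exponential with mean \<open>hoyt_gamma g \<theta> q\<close> for
  \<theta> uniform on [0, pi]. The Bessel representation and Tonelli give a mixture over \<phi>; the
  anomaly substitution makes its weights uniform.\<close>

lemma squared_hoyt_tail:
  assumes "0 < g" "0 < q" "q \<le> 1" "0 \<le> t"
  shows "(\<integral>\<^sup>+x\<in>{t..}. ennreal (squared_hoyt_density g q x) \<partial>lborel) =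
    (\<integral>\<^sup>+\<theta>\<in>{0..pi}. ennreal (exp (- t / hoyt_gamma g \<theta> q) / pi) \<partial>lborel)"
proof -
  define r where "r = (1 - q\<^sup>2) / (1 + q\<^sup>2)"
  have q2: "0 < 1 + q\<^sup>2" by (simp add: add_pos_nonneg)
  have r: "\<bar>r\<bar> < 1"
    using q2 \<open>0 < q\<close> \<open>q \<le> 1\<close> by (simp add: r_def abs_less_iff field_simps)
  then have r2: "0 < 1 - r\<^sup>2" by (simp add: abs_square_less_1)
  have pos: "0 < 1 + r * cos \<phi>" for \<phi>
  proof -
    have "\<bar>r * cos \<phi>\<bar> < 1"
      using r mult_left_le[of "\<bar>cos \<phi>\<bar>" "\<bar>r\<bar>"] by (simp add: abs_mult)
    then show ?thesis by (simp add: abs_less_iff)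
  qed
  \<comment> \<open>\<open>a \<phi>\<close> is the rate of a component; the factor \<open>b\<close>,
    common to all \<phi>, contains the 1/pi of the representation of I_0.\<close>
  define a where "a = (\<lambda>\<phi>. (1 + r * cos \<phi>) / (g * (1 - r\<^sup>2)))"
  define b where "b = 1 / (pi * (g * sqrt (1 - r\<^sup>2)))"
  have a_pos: "0 < a \<phi>" for \<phi>
    unfolding a_def using pos r2 \<open>0 < g\<close> by simp
  have b_pos: "0 < b"
    unfolding b_def using r2 \<open>0 < g\<close> by simp
  have a_cont: "continuous_on S a" for S
    unfolding a_def using r2 \<open>0 < g\<close> by (intro continuous_intros) auto
  then have [measurable]: "a \<in> borel_measurable borel"
    by (rule borel_measurable_continuous_onI)
  have dens: "ennreal (squared_hoyt_density g q x) =
      (\<integral>\<^sup>+\<phi>\<in>{0..pi}. ennreal (b * exp (- (a \<phi> * x))) \<partial>lborel)" if "0 \<le> x" for x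
  proof -
    let ?s = "x / (g * (1 - r\<^sup>2))"
    \<comment> \<open>I_0 is even, so the sign can be chosen to give the rate 1 + r cos \<phi>, the
      form that the substitution expects.\<close>
    have "bessel_I 0 (- (r * ?s)) = bessel_I 0 (r * ?s)"
      by (simp add: bessel_I_def)
    with has_integral_exp_cos[of "- (r * ?s)"]
    have "((\<lambda>\<phi>. exp (- (r * ?s * cos \<phi>))) has_integral pi * bessel_I 0 (r * ?s)) {0..pi}"
      by simp
    from has_integral_mult_right[OF this, of "b * exp (- ?s)"]
    have "((\<lambda>\<phi>. b * exp (- (a \<phi> * x))) has_integral squared_hoyt_density g q x) {0..pi}"
      unfolding squared_hoyt_density_eq[OF \<open>0 < q\<close> \<open>0 < g\<close> that r_def]
      by (simp add: a_def b_def mult.assoc add_divide_distrib ring_distribs mult_ac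
          flip: exp_add)
    then have "integral {0..pi} (\<lambda>\<phi>. b * exp (- (a \<phi> * x))) = squared_hoyt_density g q x"
      by (rule integral_unique)
    then show ?thesis
      using a_cont b_pos
      by (subst nn_integral_continuous_on_Icc) (auto intro!: continuous_intros)
  qed
  have "(\<integral>\<^sup>+x\<in>{t..}. ennreal (squared_hoyt_density g q x) \<partial>lborel) =
      (\<integral>\<^sup>+x. (\<integral>\<^sup>+\<phi>. ennreal (b * exp (- (a \<phi> * x))) * indicator {t..} x * indicator {0..pi} \<phi> \<partial>lborel) \<partial>lborel)"
    using \<open>0 \<le> t\<close> by (intro nn_integral_cong) (auto simp: dens split: split_indicator)
  also have "\<dots> =
      (\<integral>\<^sup>+\<phi>. (\<integral>\<^sup>+x. ennreal (b * exp (- (a \<phi> * x))) * indicator {t..} x * indicator {0..pi} \<phi> \<partial>lborel) \<partial>lborel)"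
    by (intro lborel_pair.Fubini') measurable
  also have "\<dots> = (\<integral>\<^sup>+\<phi>\<in>{0..pi}. ennreal (b / a \<phi> * exp (- (a \<phi> * t))) \<partial>lborel)"
    using nn_integral_exp_tail[OF a_pos less_imp_le[OF b_pos]]
    by (intro nn_integral_cong) (auto split: split_indicator)
  also have "\<dots> = ennreal (integral {0..pi} (\<lambda>\<phi>. b / a \<phi> * exp (- (a \<phi> * t))))"
    using a_pos b_pos a_cont
    by (intro nn_integral_continuous_on_Icc continuous_intros) (auto simp: less_imp_le less_imp_neq[symmetric])
  \<comment> \<open>The weight \<open>b / a \<phi>\<close> is 1/pi times the Jacobian of the
    substitution, applied next with h(y) = exp(-(t/g) y) / pi.\<close>
  also have "(\<lambda>\<phi>. b / a \<phi> * exp (- (a \<phi> * t))) =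
      (\<lambda>\<phi>. sqrt (1 - r\<^sup>2) / (1 + r * cos \<phi>) * (exp (- (t / g) * ((1 + r * cos \<phi>) / (1 - r\<^sup>2))) / pi))"
  proof
    fix \<phi>
    have "b / a \<phi> = sqrt (1 - r\<^sup>2) / (1 + r * cos \<phi>) / pi"
      unfolding a_def b_def using r2 pos[of \<phi>] \<open>0 < g\<close> real_sqrt_mult_self[of "1 - r\<^sup>2"]
      by (simp add: divide_simps)
    then show "b / a \<phi> * exp (- (a \<phi> * t)) =
        sqrt (1 - r\<^sup>2) / (1 + r * cos \<phi>) * (exp (- (t / g) * ((1 + r * cos \<phi>) / (1 - r\<^sup>2))) / pi)"
      by (simp add: a_def mult_ac)
  qed
  also have "integral {0..pi} \<dots> =
      integral {0..pi} (\<lambda>\<theta>. exp (- (t / g) * (1 / (1 - r * cos \<theta>))) / pi)"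
    by (rule integral_anomaly_substitution[OF r, symmetric]) (intro continuous_intros, simp)
  also have "(\<lambda>\<theta>. exp (- (t / g) * (1 / (1 - r * cos \<theta>))) / pi) =
      (\<lambda>\<theta>. exp (- t / hoyt_gamma g \<theta> q) / pi)"
    by (simp add: hoyt_gamma_def r_def)
  also have "ennreal (integral {0..pi} \<dots>) =
      (\<integral>\<^sup>+\<theta>\<in>{0..pi}. ennreal (exp (- t / hoyt_gamma g \<theta> q) / pi) \<partial>lborel)"
  proof (rule nn_integral_continuous_on_Icc[symmetric])
    \<comment> \<open>Taking \<open>pos\<close> at pi - \<theta> flips the sign of the
      cosine.\<close>
    have "hoyt_gamma g \<theta> q > 0" for \<theta>
      using pos[of "pi - \<theta>"] \<open>0 < g\<close> by (simp add: hoyt_gamma_def r_def cos_diff)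
    then show "continuous_on {0..pi} (\<lambda>\<theta>. exp (- t / hoyt_gamma g \<theta> q) / pi)"
      unfolding hoyt_gamma_def by (intro continuous_intros) (metis less_irrefl, simp)
  qed simp
  finally show ?thesis .
qed

section \<open>Outage probability by averaging the tail over the interference\<close>

theorem proposition3:
  fixes M :: "'a measure"
    and X Y :: "'a \<Rightarrow> real"
    and \<gamma>avg q \<gamma>o :: real
  assumes "prob_space M"
    and "\<gamma>avg > 0" and "0 < q" and "q \<le> 1" and "\<gamma>o > 0"
    and "distributed M lborel X (\<lambda>x. ennreal (squared_hoyt_density \<gamma>avg q x))"
    and "Y \<in> borel_measurable M" and "AE \<omega> in M. Y \<omega> \<ge> 0"
    and "prob_space.indep_var M borel X borel Y"
  shows "\<P>(\<omega> in M. X \<omega> < \<gamma>o * (Y \<omega> + 1)) =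
    1 - 1 / pi * (LBINT \<theta>=0..pi.
      exp (- \<gamma>o / hoyt_gamma \<gamma>avg \<theta> q)
        * moment_gen_fun M Y (- \<gamma>o / hoyt_gamma \<gamma>avg \<theta> q))"
proof -
  interpret prob_space M by fact
  note Y[measurable] = \<open>Y \<in> borel_measurable M\<close>
  have X[measurable]: "X \<in> borel_measurable M"
    using distributed_measurable[OF assms(6)] by simp
  interpret X: prob_space "distr M borel X" by (rule prob_space_distr) simp
  interpret Y: prob_space "distr M borel Y" by (rule prob_space_distr) simp
  interpret XY: pair_prob_space "distr M borel X" "distr M borel Y" ..
  \<comment> \<open>The density is stated relative to \<open>lborel\<close>, independence relative
    to \<open>borel\<close>; their measurable sets coincide.\<close>
  have distr_X: "distr M borel X = density lborel (\<lambda>x. ennreal (squared_hoyt_density \<gamma>avg q x))"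
    using distributed_distr_eq_density[OF assms(6)] distr_cong[of M M lborel borel X X] by simp
  let ?\<gamma> = "\<lambda>\<theta>. hoyt_gamma \<gamma>avg \<theta> q"
  have [measurable]: "?\<gamma> \<in> borel_measurable borel"
    unfolding hoyt_gamma_def by measurable
  have \<gamma>_pos: "0 < ?\<gamma> \<theta>" for \<theta>
  proof -
    have "0 \<le> (1 - q\<^sup>2) / (1 + q\<^sup>2)" "(1 - q\<^sup>2) / (1 + q\<^sup>2) < 1"
      using \<open>0 < q\<close> \<open>q \<le> 1\<close> by (auto simp: power_le_one_iff field_simps add_pos_nonneg)
    then have "(1 - q\<^sup>2) / (1 + q\<^sup>2) * cos \<theta> < 1"
      using mult_left_le[of "cos \<theta>" "(1 - q\<^sup>2) / (1 + q\<^sup>2)"] by (simp del: times_divide_eq_left)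
    then show ?thesis
      unfolding hoyt_gamma_def using \<open>0 < \<gamma>avg\<close> by simp
  qed
  define G where "G \<theta> = exp (- \<gamma>o / ?\<gamma> \<theta>) * moment_gen_fun M Y (- \<gamma>o / ?\<gamma> \<theta>)" for \<theta>
  have [measurable]: "G \<in> borel_measurable borel"
    unfolding G_def moment_gen_fun_def by measurable
  have G_nonneg: "0 \<le> G \<theta>" for \<theta>
    unfolding G_def moment_gen_fun_def by simp
  have G: "(\<integral>\<^sup>+\<omega>. ennreal (exp (- (\<gamma>o * (Y \<omega> + 1)) / ?\<gamma> \<theta>)) \<partial>M) = ennreal (G \<theta>)" for \<theta>
  proof -
    \<comment> \<open>For Y \<ge> 0 the exponent is nonpositive. The bound gives integrability, so
      the Bochner integral in \<open>moment_gen_fun\<close> is genuine and not the default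
      0.\<close>
    have "AE \<omega> in M. norm (exp (- \<gamma>o / ?\<gamma> \<theta> * Y \<omega>)) \<le> 1"
      using assms(8) \<gamma>_pos[of \<theta>] \<open>0 < \<gamma>o\<close> by (auto simp: field_simps)
    from integrable_const_bound[OF this] have "integrable M (\<lambda>\<omega>. exp (- \<gamma>o / ?\<gamma> \<theta> * Y \<omega>))"
      by simp
    then have "(\<integral>\<^sup>+\<omega>. ennreal (exp (- \<gamma>o / ?\<gamma> \<theta>) * exp (- \<gamma>o / ?\<gamma> \<theta> * Y \<omega>)) \<partial>M) = ennreal (G \<theta>)"
      unfolding G_def moment_gen_fun_def by (subst nn_integral_eq_integral) auto
    then show ?thesis
      by (simp add: exp_add[symmetric] distrib_left add_divide_distrib add.commute diff_divide_distrib)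
  qed
  let ?A = "{\<omega>\<in>space M. \<gamma>o * (Y \<omega> + 1) \<le> X \<omega>}"
  have "emeasure M ?A = (\<integral>\<^sup>+\<omega>. indicator ?A \<omega> \<partial>M)"
    by simp
  also have "\<dots> = (\<integral>\<^sup>+\<omega>. indicator {p. \<gamma>o * (snd p + 1) \<le> fst p} (X \<omega>, Y \<omega>) \<partial>M)"
    by (intro nn_integral_cong) (simp split: split_indicator)
  also have "\<dots> = (\<integral>\<^sup>+p. indicator {p. \<gamma>o * (snd p + 1) \<le> fst p} p
      \<partial>distr M (borel \<Otimes>\<^sub>M borel) (\<lambda>\<omega>. (X \<omega>, Y \<omega>)))"
    by (subst nn_integral_distr) auto
  \<comment> \<open>Independence makes the joint law a product, so X can be integrated with Y held
    fixed.\<close>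
  also have "distr M (borel \<Otimes>\<^sub>M borel) (\<lambda>\<omega>. (X \<omega>, Y \<omega>)) = distr M borel X \<Otimes>\<^sub>M distr M borel Y"
    using assms(9) by (simp add: indep_var_distribution_eq)
  also have "(\<integral>\<^sup>+p. indicator {p. \<gamma>o * (snd p + 1) \<le> fst p} p \<partial>(distr M borel X \<Otimes>\<^sub>M distr M borel Y)) =
      (\<integral>\<^sup>+y. (\<integral>\<^sup>+x. indicator {p. \<gamma>o * (snd p + 1) \<le> fst p} (x, y) \<partial>distr M borel X) \<partial>distr M borel Y)"
    by (rule XY.nn_integral_snd[symmetric]) auto
  also have "\<dots> = (\<integral>\<^sup>+\<omega>. (\<integral>\<^sup>+x. indicator {p. \<gamma>o * (snd p + 1) \<le> fst p} (x, Y \<omega>) \<partial>distr M borel X) \<partial>M)"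
    by (rule nn_integral_distr) measurable
  also have "\<dots> = (\<integral>\<^sup>+\<omega>. (\<integral>\<^sup>+x\<in>{\<gamma>o * (Y \<omega> + 1)..}. ennreal (squared_hoyt_density \<gamma>avg q x) \<partial>lborel) \<partial>M)"
    unfolding distr_X using distributed_borel_measurable[OF assms(6)]
    by (intro nn_integral_cong) (subst nn_integral_density, auto intro!: nn_integral_cong split: split_indicator)
  \<comment> \<open>The tail formula is available for nonnegative thresholds, and Y \<ge> 0 holds
    almost everywhere; hence the congruence is an AE one.\<close>
  also have "\<dots> = (\<integral>\<^sup>+\<omega>. (\<integral>\<^sup>+\<theta>\<in>{0..pi}. ennreal (exp (- (\<gamma>o * (Y \<omega> + 1)) / ?\<gamma> \<theta>) / pi) \<partial>lborel) \<partial>M)"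
    using assms(8)
  proof (intro nn_integral_cong_AE, eventually_elim)
    case (elim \<omega>)
    then have "0 \<le> \<gamma>o * (Y \<omega> + 1)" using \<open>0 < \<gamma>o\<close> by simp
    from squared_hoyt_tail[OF assms(2-4) this] show ?case .
  qed
  \<comment> \<open>With \<theta> outermost, the inner expectation over \<omega> becomes
    \<open>G \<theta>\<close>, the noise factor times the moment generating function.\<close>
  also have "\<dots> = (\<integral>\<^sup>+\<theta>. (\<integral>\<^sup>+\<omega>. ennreal (exp (- (\<gamma>o * (Y \<omega> + 1)) / ?\<gamma> \<theta>) / pi) * indicator {0..pi} \<theta> \<partial>M) \<partial>lborel)"
  proof -
    interpret P: pair_sigma_finite lborel M ..
    show ?thesis by (rule P.Fubini') measurable
  qed
  also have "\<dots> = (\<integral>\<^sup>+\<theta>. ennreal (1 / pi * (indicator {0..pi} \<theta> *\<^sub>R G \<theta>)) \<partial>lborel)"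
  proof (rule nn_integral_cong)
    fix \<theta> :: real
    have "(\<integral>\<^sup>+\<omega>. ennreal (exp (- (\<gamma>o * (Y \<omega> + 1)) / ?\<gamma> \<theta>) / pi) * indicator {0..pi} \<theta> \<partial>M) =
        (\<integral>\<^sup>+\<omega>. ennreal (indicator {0..pi} \<theta> / pi) * ennreal (exp (- (\<gamma>o * (Y \<omega> + 1)) / ?\<gamma> \<theta>)) \<partial>M)"
      by (rule nn_integral_cong) (simp split: split_indicator flip: ennreal_mult)
    also have "\<dots> = ennreal (indicator {0..pi} \<theta> / pi) * ennreal (G \<theta>)"
      by (subst nn_integral_cmult, measurable) (simp only: G)
    finally show "(\<integral>\<^sup>+\<omega>. ennreal (exp (- (\<gamma>o * (Y \<omega> + 1)) / ?\<gamma> \<theta>) / pi) * indicator {0..pi} \<theta> \<partial>M) =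
        ennreal (1 / pi * (indicator {0..pi} \<theta> *\<^sub>R G \<theta>))"
      using G_nonneg by (simp flip: ennreal_mult)
  qed
  finally have "prob ?A = (\<integral>\<theta>. 1 / pi * (indicator {0..pi} \<theta> *\<^sub>R G \<theta>) \<partial>lborel)"
    using G_nonneg by (subst integral_eq_nn_integral) (auto simp: measure_def)
  also have "\<dots> = 1 / pi * (LBINT \<theta>=0..pi. G \<theta>)"
    \<comment> \<open>Folding is needed because the lower limit is the extended real
      \<open>0\<close>, not \<open>ereal 0\<close>.\<close>
    by (simp add: interval_integral_Icc[of 0 pi, folded zero_ereal_def] set_lebesgue_integral_def)
  finally have A: "prob ?A = 1 / pi * (LBINT \<theta>=0..pi. G \<theta>)" .
  have "{\<omega>\<in>space M. X \<omega> < \<gamma>o * (Y \<omega> + 1)} = space M - ?A" by auto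
  then show ?thesis
    using prob_compl[of ?A] by (simp add: A G_def)
qed

end
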